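(* Let $S$ be an additively idempotent semiring. Then every absolutely $k$-prime ideal of $S$ is $k$-prime.
   Context: A semiring is a commutative semiring $(S,+,0,\cdot,1)$ with multiplicative identity $1$ and additive identity $0$ that is absorbing. It is additively idempotent if $x+x=x$ for all $x$. An ideal is a nonempty subset closed under addition and under multiplication by elements of $S$. A $k$-ideal is an ideal $I$ such that $x+y\in I$ and $y\in I$ imply $x\in I$. A $k$-ideal $I$ is $k$-prime if for all $k$-ideals $A,B$, $AB\subseteq I$ implies $A\subseteq I$ or $B\subseteq I$, where $AB$ is the ideal of finite sums of products $ab$ with $a\in A$, $b\in B$. For an ideal $I$, the congruence $\rho_I$ is defined by $x\,\rho_I\,y$ iff $x+z=y+z$ for some $z\in I$, and $\bar I:=\{x\in S: x+z=z\text{ for some }z\in I\}$. An ideal $I$ is absolutely prime if $I\neq S$ and, for all $a,b,c\in S$, $(ab)\,\rho_I\,(ac)$ implies $a\in\bar I$ or $b\,\rho_I\,c$. $I$ is absolutely $k$-prime if it is a $k$-ideal and absolutely prime. *)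

theory Defs
  imports Main
begin

text \<open>
  The sort \<open>{comm_semiring_0, comm_monoid_mult}\<close> is a commutative semiring with absorbing \<open>0\<close>
  and identity \<open>1\<close>.  Unlike \<open>comm_semiring_1\<close> it does not demand \<open>0 \<noteq> 1\<close>.
\<close>

definition additively_idempotent :: "'a::{comm_semiring_0, comm_monoid_mult} itself \<Rightarrow> bool" where
  "additively_idempotent _ \<longleftrightarrow> (\<forall>x::'a. x + x = x)"

definition sr_ideal :: "'a::{comm_semiring_0, comm_monoid_mult} set \<Rightarrow> bool" where
  "sr_ideal I \<longleftrightarrow> I \<noteq> {} \<and> (\<forall>x\<in>I. \<forall>y\<in>I. x + y \<in> I) \<and> (\<forall>s. \<forall>x\<in>I. s * x \<in> I)"

definition k_ideal :: "'a::{comm_semiring_0, comm_monoid_mult} set \<Rightarrow> bool" where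
  "k_ideal I \<longleftrightarrow> sr_ideal I \<and> (\<forall>x y. x + y \<in> I \<and> y \<in> I \<longrightarrow> x \<in> I)"

definition ideal_prod ::
  "'a::{comm_semiring_0, comm_monoid_mult} set \<Rightarrow> 'a set \<Rightarrow> 'a set" where
  "ideal_prod A B =
     {\<Sum>i<n. a i * b i | (n::nat) a b. \<forall>i<n. a i \<in> A \<and> b i \<in> B}"

definition k_prime :: "'a::{comm_semiring_0, comm_monoid_mult} set \<Rightarrow> bool" where
  "k_prime I \<longleftrightarrow> k_ideal I \<and>
     (\<forall>A B. k_ideal A \<longrightarrow> k_ideal B \<longrightarrow> ideal_prod A B \<subseteq> I \<longrightarrow> A \<subseteq> I \<or> B \<subseteq> I)"

definition ideal_cong :: "'a::{comm_semiring_0, comm_monoid_mult} set \<Rightarrow> 'a \<Rightarrow> 'a \<Rightarrow> bool" where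
  "ideal_cong I x y \<longleftrightarrow> (\<exists>z\<in>I. x + z = y + z)"

text \<open>The set written \<open>I\<close> with an overline; the witness \<open>z\<close> also occurs on the right-hand side.\<close>

definition ideal_bar :: "'a::{comm_semiring_0, comm_monoid_mult} set \<Rightarrow> 'a set" where
  "ideal_bar I = {x. \<exists>z\<in>I. x + z = z}"

definition absolutely_prime :: "'a::{comm_semiring_0, comm_monoid_mult} set \<Rightarrow> bool" where
  "absolutely_prime I \<longleftrightarrow> sr_ideal I \<and> I \<noteq> UNIV \<and>
     (\<forall>a b c. ideal_cong I (a * b) (a * c) \<longrightarrow> a \<in> ideal_bar I \<or> ideal_cong I b c)"

definition absolutely_k_prime :: "'a::{comm_semiring_0, comm_monoid_mult} set \<Rightarrow> bool" where
  "absolutely_k_prime I \<longleftrightarrow> k_ideal I \<and> absolutely_prime I"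

end

(* If ab lies in I, then ab + ab = ab = a0 + ab shows that ab and a0 are congruent modulo I;
   absolute primeness then gives a or b in the bar closure of I, which is I for a k-ideal. *)
theory Submission
  imports Defs
begin

text \<open>Primeness is first obtained for elements (\<open>absolutely_k_prime_mult_memD\<close>):
  by idempotence a product in \<open>I\<close> is congruent to 0, and absolute primeness splits it.
  It passes to ideals because products of elements lie in \<open>ideal_prod A B\<close>.\<close>

lemma ideal_bar_subset:
  assumes "k_ideal I"
  shows "ideal_bar I \<subseteq> I"
proof
  fix x
  assume "x \<in> ideal_bar I"
  then obtain z where "z \<in> I" "x + z = z"
    unfolding ideal_bar_def by blast
  with assms show "x \<in> I"
    unfolding k_ideal_def by metis
qed

text \<open>Turns the second alternative of absolute primeness, taken at \<open>c = 0\<close>, into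
  the same form as the first.\<close>

lemma ideal_cong_zero_iff: "ideal_cong I x 0 \<longleftrightarrow> x \<in> ideal_bar I"
  by (simp add: ideal_cong_def ideal_bar_def)

lemma mult_mem_ideal_prod:
  assumes "a \<in> A" "b \<in> B"
  shows "a * b \<in> ideal_prod A B"
  unfolding ideal_prod_def mem_Collect_eq
  using assms by (intro exI[of _ "1::nat"] exI[of _ "\<lambda>_. a"] exI[of _ "\<lambda>_. b"]) simp

lemma absolutely_k_prime_mult_memD:
  fixes I :: "'a::{comm_semiring_0, comm_monoid_mult} set"
  assumes idem: "additively_idempotent TYPE('a)"
    and I: "absolutely_k_prime I"
    and ab: "a * b \<in> I"
  shows "a \<in> I \<or> b \<in> I"
proof -
  \<comment> \<open>Writing 0 as \<open>a * 0\<close> exposes the common factor \<open>a\<close>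
    that absolute primeness cancels.\<close>
  have "a * b + a * b = a * 0 + a * b"
    using idem by (simp add: additively_idempotent_def)
  with ab have "ideal_cong I (a * b) (a * 0)"
    unfolding ideal_cong_def by blast
  with I have "a \<in> ideal_bar I \<or> ideal_cong I b 0"
    unfolding absolutely_k_prime_def absolutely_prime_def by blast
  moreover have "ideal_bar I \<subseteq> I"
    using I by (simp add: absolutely_k_prime_def ideal_bar_subset)
  ultimately show ?thesis
    by (auto simp: ideal_cong_zero_iff)
qed

theorem theorem6p30:
  fixes I :: "'a::{comm_semiring_0, comm_monoid_mult} set"
  assumes "additively_idempotent TYPE('a)"
    and "absolutely_k_prime I"
  shows "k_prime I"
  unfolding k_prime_def
proof (intro conjI allI impI)
  show "k_ideal I"
    using assms(2) by (simp add: absolutely_k_prime_def)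
next
  fix A B :: "'a set"
  assume "ideal_prod A B \<subseteq> I"
  then have "a \<in> I \<or> b \<in> I" if "a \<in> A" "b \<in> B" for a b
    using that mult_mem_ideal_prod absolutely_k_prime_mult_memD[OF assms] by blast
  \<comment> \<open>Otherwise some \<open>a\<close> in \<open>A\<close> and \<open>b\<close> in
    \<open>B\<close> would both lie outside \<open>I\<close>.\<close>
  then show "A \<subseteq> I \<or> B \<subseteq> I"
    by blast
qed

end
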